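(* Let $a>1$, $h(x)=1+ax(1-x)$, $\nu>0$. For each $C\ge1$ let $(x_k^C(t),0\le k\le C)$ be the solution of the system (DAR) with $\lambda=\nu C$, with initial points such that $$\lim_{C\to+\infty}\bigl\|(x_{C-k}^C(0),k\in\mathbb{N})-(q_0(k),k\in\mathbb{N})\bigr\|=0$$ for some probability distribution $q_0\in\mathcal{P}(\mathbb{N})$. Then, as $C$ goes to infinity, the process $$(y_k^C(t),k\in\mathbb{N}):=\bigl(x_{C-k}^C(t/C),k\in\mathbb{N}\bigr)$$ converges in distribution, for the uniform norm $\|\cdot\|_T$ for every $T>0$, to $(\Gamma(t))\in\mathcal{C}(\mathbb{R}_+,\mathcal{P}(\mathbb{N}))$, $\Gamma(t)=(\Gamma_k(t),k\in\mathbb{N})$, which is the unique solution of the set of differential equations $$\frac{\mathrm{d}}{\mathrm{d}t}\Gamma_0(t)=\nu h(\Gamma_0(t))\,\Gamma_1(t)-\Gamma_0(t),$$ $$\frac{\mathrm{d}}{\mathrm{d}t}\Gamma_k(t)=\nu h(\Gamma_0(t))\,\Gamma_{k+1}(t)+\Gamma_{k-1}(t)-\bigl(\nu h(\Gamma_0(t))+1\bigr)\Gamma_k(t),\quad k\ge1,$$ with $\Gamma(0)=q_0$.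
   Context: The system (DAR): for each $t\ge0$, $(x_k^C(t),0\le k\le C)$ is a probability distribution on $\{0,\dots,C\}$ and, for $1\le j<C$, $$\frac{\mathrm{d}x_0^C}{\mathrm{d}t}(t)=x_1^C(t)-\lambda h(x_C^C(t))\,x_0^C(t),$$ $$\frac{\mathrm{d}x_j^C}{\mathrm{d}t}(t)=\lambda h(x_C^C(t))\,x_{j-1}^C(t)+(j+1)x_{j+1}^C(t)-\bigl(\lambda h(x_C^C(t))+j\bigr)x_j^C(t),$$ $$\frac{\mathrm{d}x_C^C}{\mathrm{d}t}(t)=\lambda h(x_C^C(t))\,x_{C-1}^C(t)-C\,x_C^C(t).$$ By convention $x_{C-k}^C=0$ for $k>C$. $\mathbb{N}=\{0,1,2,\dots\}$; $\mathcal{P}(\mathbb{N})$ is the set of probability distributions on $\mathbb{N}$. For a bounded sequence $z=(z_k)$, $\|z\|=\sum_{k\ge0}2^{-k}|z_k|$, and for a continuous function $(z(t))$ with values in bounded sequences, $\|z\|_T=\sup_{0\le t\le T}\|z(t)\|$. The functions $(y_k^C(t))$ are deterministic, so convergence in distribution means convergence in the stated norm. *)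

theory Defs
  imports "HOL-Probability.Probability"
begin

text \<open>
  Probability distributions on the natural numbers are elements of \<^typ>\<open>nat pmf\<close>; the
  \<open>k\<close>-th coordinate of \<open>p\<close> is \<^term>\<open>pmf p k\<close>. A trajectory indexed by
  nonnegative times is a function on \<^typ>\<open>real\<close> of which only the values at
  \<open>t \<ge> 0\<close> matter; derivatives at \<open>0\<close> are one-sided (within \<^term>\<open>{0::real..}\<close>).
\<close>

text \<open>Meant for bounded sequences, for which the series converges.\<close>

definition wnorm :: "(nat \<Rightarrow> real) \<Rightarrow> real" where
  "wnorm z = (\<Sum>k. \<bar>z k\<bar> / 2 ^ k)"

text \<open>Meant for trajectories whose norm is bounded on \<open>[0, T]\<close>.\<close>

definition wnorm_upto :: "real \<Rightarrow> (real \<Rightarrow> nat \<Rightarrow> real) \<Rightarrow> real" where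
  "wnorm_upto T z = (SUP t\<in>{0..T}. wnorm (z t))"

definition DAR :: "(real \<Rightarrow> real) \<Rightarrow> real \<Rightarrow> nat \<Rightarrow> (real \<Rightarrow> nat pmf) \<Rightarrow> bool" where
  "DAR h lam C x \<longleftrightarrow>
    (\<forall>t\<ge>0.
      set_pmf (x t) \<subseteq> {0..C} \<and>
      ((\<lambda>s. pmf (x s) 0) has_real_derivative
         pmf (x t) 1 - lam * h (pmf (x t) C) * pmf (x t) 0) (at t within {0..}) \<and>
      (\<forall>j. 1 \<le> j \<and> j < C \<longrightarrow>
        ((\<lambda>s. pmf (x s) j) has_real_derivative
           lam * h (pmf (x t) C) * pmf (x t) (j - 1) + real (j + 1) * pmf (x t) (j + 1)
             - (lam * h (pmf (x t) C) + real j) * pmf (x t) j) (at t within {0..})) \<and>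
      ((\<lambda>s. pmf (x s) C) has_real_derivative
         lam * h (pmf (x t) C) * pmf (x t) (C - 1) - real C * pmf (x t) C) (at t within {0..}))"

text \<open>
  The sequence \<open>(x\<^bsub>C-k\<^esub>)\<close>, \<open>k \<in> \<nat>\<close>, extended by \<open>0\<close> for \<open>k > C\<close>; the case distinction
  is needed because subtraction on \<^typ>\<open>nat\<close> truncates.
\<close>

definition reflect :: "nat \<Rightarrow> nat pmf \<Rightarrow> nat \<Rightarrow> real" where
  "reflect C p k = (if k \<le> C then pmf p (C - k) else 0)"

text \<open>
  Continuity into the space of probability distributions, with the topology of
  \<^const>\<open>wnorm\<close>, which on that space is the topology of weak convergence.
\<close>

definition continuous_path :: "(real \<Rightarrow> nat pmf) \<Rightarrow> bool" where
  "continuous_path G \<longleftrightarrow>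
    (\<forall>t\<ge>0. ((\<lambda>s. wnorm (\<lambda>k. pmf (G s) k - pmf (G t) k)) \<longlongrightarrow> 0) (at t within {0..}))"

definition limit_system :: "(real \<Rightarrow> real) \<Rightarrow> real \<Rightarrow> (real \<Rightarrow> nat pmf) \<Rightarrow> bool" where
  "limit_system h nu G \<longleftrightarrow>
    (\<forall>t\<ge>0.
      ((\<lambda>s. pmf (G s) 0) has_real_derivative
         nu * h (pmf (G t) 0) * pmf (G t) 1 - pmf (G t) 0) (at t within {0..}) \<and>
      (\<forall>k\<ge>1.
        ((\<lambda>s. pmf (G s) k) has_real_derivative
           nu * h (pmf (G t) 0) * pmf (G t) (k + 1) + pmf (G t) (k - 1)
             - (nu * h (pmf (G t) 0) + 1) * pmf (G t) k) (at t within {0..})))"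

end

theory Submission
  imports Defs
begin

text \<open>
  In the reflected and rescaled coordinates the finite system is the limit system up to an error
  of at most \<open>2/C\<close> in the norm \<open>sup\<^sub>k (2/3)^k \<bar>z\<^sub>k\<bar>\<close>. For this norm the right-hand side of the limit
  system is Lipschitz on sequences with values in \<open>[0, 1]\<close>, so a Gronwall estimate compares any two
  approximate solutions. It gives uniqueness, and it shows that the rescaled processes form a
  Cauchy sequence, whose limit solves the limit system; no separate existence theorem is needed.
  On bounded sequences, smallness in this norm and in \<^const>\<open>wnorm\<close> are equivalent. That the limit
  has total mass one follows since mass flows at a bounded rate.
\<close>

section \<open>Comparison of functions through their derivatives on the half-line\<close>

lemma le_if_deriv_le:
  fixes f g :: "real \<Rightarrow> real"
  assumes t: "0 \<le> t"
    and f: "\<And>s. s \<in> {0..t} \<Longrightarrow> (f has_real_derivative f' s) (at s within {0..})"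
    and g: "\<And>s. s \<in> {0..t} \<Longrightarrow> (g has_real_derivative g' s) (at s within {0..})"
    and le: "\<And>s. s \<in> {0..t} \<Longrightarrow> f' s \<le> g' s"
    and init: "f 0 \<le> g 0"
  shows "f t \<le> g t"
proof -
  have "((\<lambda>s. g s - f s) has_derivative (\<lambda>x. (g' s - f' s) * x)) (at s within {0..t})"
    if "0 \<le> s" "s \<le> t" for s
    using DERIV_subset[OF DERIV_diff[OF g f], of s "{0..t}"] that
    by (auto simp: has_field_derivative_def)
  from mvt_very_simple[OF t this]
  obtain s where "s \<in> {0..t}" "(g t - f t) - (g 0 - f 0) = (g' s - f' s) * (t - 0)"
    by blast
  moreover from this have "(g' s - f' s) * (t - 0) \<ge> 0"
    using le[of s] t by simp
  ultimately show ?thesis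
    using init by linarith
qed

lemma abs_diff_le_if_deriv_le:
  fixes f :: "real \<Rightarrow> real"
  assumes f: "\<And>s. 0 \<le> s \<Longrightarrow> (f has_real_derivative f' s) (at s within {0..})"
    and le: "\<And>s. 0 \<le> s \<Longrightarrow> \<bar>f' s\<bar> \<le> B" and "0 \<le> s" "0 \<le> t"
  shows "\<bar>f s - f t\<bar> \<le> B * \<bar>s - t\<bar>"
  using field_differentiable_bound[of "{0..}" f f' B s t] assms by auto

section \<open>The limit vector field: bounds, Lipschitz estimate and stability\<close>

locale logistic_rate =
  fixes a nu :: real and h :: "real \<Rightarrow> real"
  assumes a_pos: "a > 0" and nu_pos: "nu > 0"
    and h_eq: "h u = 1 + a * u * (1 - u)"
begin

text \<open>One formula serves \<open>k = 0\<close> and \<open>k >= 1\<close>. The terms are grouped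
  by direction of transport, each group being a difference, so that partial sums over
  \<open>k\<close> telescope.\<close>

definition rhs :: "(nat \<Rightarrow> real) \<Rightarrow> nat \<Rightarrow> real" where
  "rhs z k = nu * h (z 0) * (z (Suc k) - (if k = 0 then 0 else z k))
     + ((if k = 0 then 0 else z (k - 1)) - z k)"

text \<open>\<open>5/2 = 3/2 + 1\<close> collects the weights of coordinates \<open>k + 1\<close>
  and \<open>k\<close>, multiplied by the bound \<open>1 + a\<close> on \<open>h\<close>; the next
  \<open>a\<close> is the Lipschitz constant of \<open>h\<close>; the final \<open>2\<close> comes
  from coordinates \<open>k - 1\<close> and \<open>k\<close>.\<close>

definition lip :: real where
  "lip = nu * (5 / 2 * (1 + a) + a) + 2"

text \<open>The ratio \<open>3/2\<close> lies strictly between 1 and 2: exceeding 1, it lets the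
  weights absorb an error that grows linearly in \<open>k\<close>; being below 2, it keeps the
  series in \<open>wnorm\<close> convergent.\<close>

definition approx_solution :: "real \<Rightarrow> real \<Rightarrow> (real \<Rightarrow> nat \<Rightarrow> real) \<Rightarrow> bool" where
  "approx_solution T \<delta> u \<longleftrightarrow> (\<forall>t\<in>{0..T}. \<forall>k. u t k \<in> {0..1} \<and>
     (\<exists>D. ((\<lambda>s. u s k) has_real_derivative D) (at t within {0..}) \<and>
          \<bar>D - rhs (u t) k\<bar> \<le> \<delta> * (3 / 2) ^ k))"

lemma lip_pos: "lip > 0"
  using a_pos nu_pos by (simp add: lip_def add_pos_pos)

lemma h_bounds: assumes "u \<in> {0..1}" shows "0 \<le> h u" "h u \<le> 1 + a"
proof -
  have "0 \<le> a * (u * (1 - u))" "a * (u * (1 - u)) \<le> a * 1"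
    using assms a_pos mult_le_one[of u "1 - u"] by (auto intro!: mult_left_mono)
  then show "0 \<le> h u" "h u \<le> 1 + a"
    by (auto simp: h_eq mult.assoc)
qed

lemma h_lipschitz:
  assumes "u \<in> {0..1}" "v \<in> {0..1}"
  shows "\<bar>h u - h v\<bar> \<le> a * \<bar>u - v\<bar>"
proof -
  have "h u - h v = a * ((u - v) * (1 - u - v))"
    by (simp add: h_eq algebra_simps)
  then have "\<bar>h u - h v\<bar> = a * (\<bar>u - v\<bar> * \<bar>1 - u - v\<bar>)"
    using a_pos by (simp add: abs_mult)
  also have "\<dots> \<le> a * (\<bar>u - v\<bar> * 1)"
    using assms a_pos by (intro mult_left_mono) auto
  finally show ?thesis by simp
qed

text \<open>The variation of the product with \<open>h\<close> is split in two: one part varies the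
  coordinates and uses \<open>h <= 1 + a\<close>, the other varies \<open>h\<close> and uses that
  coordinate differences of \<open>v\<close> are at most 1. This is where values in
  \<open>[0, 1]\<close> enter.\<close>

lemma rhs_lipschitz:
  assumes u: "\<And>k. u k \<in> {0..1}" and v: "\<And>k. v k \<in> {0..1}"
    and le: "\<And>k. \<bar>u k - v k\<bar> \<le> \<phi> * (3 / 2) ^ k"
  shows "\<bar>rhs u k - rhs v k\<bar> \<le> lip * \<phi> * (3 / 2) ^ k"
proof -
  let ?r = "(3 / 2) ^ k :: real"
  let ?p = "\<lambda>z :: nat \<Rightarrow> real. z (Suc k) - (if k = 0 then 0 else z k)"
  let ?m = "\<lambda>z :: nat \<Rightarrow> real. (if k = 0 then 0 else z (k - 1)) - z k"
  have \<phi>: "0 \<le> \<phi>" using le[of 0] by simp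
  have p: "\<bar>?p u - ?p v\<bar> \<le> 5 / 2 * \<phi> * ?r"
    using le[of k] le[of "Suc k"] \<phi> by (cases "k = 0") (auto simp: abs_if split: if_splits)
  have pv: "\<bar>?p v\<bar> \<le> 1"
    using v[of k] v[of "Suc k"] by (cases "k = 0") (auto simp: abs_if)
  have "\<phi> * (3 / 2) ^ (k - 1) \<le> \<phi> * ?r"
    using \<phi> by (intro mult_left_mono power_increasing) auto
  then have m: "\<bar>?m u - ?m v\<bar> \<le> 2 * \<phi> * ?r"
    using le[of k] le[of "k - 1"] \<phi> by (auto simp: abs_if split: if_splits)
  \<comment> \<open>At every \<open>k\<close>, \<open>h\<close> sees coordinate 0 only; its error
    \<open>\<phi>\<close> fits the weighted bound because all weights are at least 1.\<close>
  have "\<phi> * 1 \<le> \<phi> * ?r"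
    using \<phi> by (intro mult_left_mono) auto
  then have "a * \<bar>u 0 - v 0\<bar> \<le> a * (\<phi> * ?r)"
    using le[of 0] a_pos by (intro mult_left_mono) auto
  then have h0: "\<bar>h (u 0) - h (v 0)\<bar> \<le> a * (\<phi> * ?r)"
    using h_lipschitz[OF u[of 0] v[of 0]] by linarith
  have split_difference: "nu * hu * pu + mu - (nu * hv * pv + mv)
      = nu * (hu * (pu - pv) + (hu - hv) * pv) + (mu - mv)" for hu hv pu pv mu mv
    by (simp add: algebra_simps)
  have triangle: "\<bar>nu * (A * B + A' * B') + D\<bar> \<le> nu * (\<bar>A\<bar> * \<bar>B\<bar> + \<bar>A'\<bar> * \<bar>B'\<bar>) + \<bar>D\<bar>" for A A' B B' D
  proof -
    have "\<bar>nu * (A * B + A' * B')\<bar> \<le> nu * (\<bar>A\<bar> * \<bar>B\<bar> + \<bar>A'\<bar> * \<bar>B'\<bar>)"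
      using nu_pos abs_triangle_ineq[of "A * B" "A' * B'"] by (simp add: abs_mult)
    then show ?thesis by linarith
  qed
  have "rhs u k - rhs v k = nu * (h (u 0) * (?p u - ?p v) + (h (u 0) - h (v 0)) * ?p v) + (?m u - ?m v)"
    unfolding rhs_def by (rule split_difference)
  then have "\<bar>rhs u k - rhs v k\<bar>
      \<le> nu * (\<bar>h (u 0)\<bar> * \<bar>?p u - ?p v\<bar> + \<bar>h (u 0) - h (v 0)\<bar> * \<bar>?p v\<bar>) + \<bar>?m u - ?m v\<bar>"
    by (simp only: triangle)
  also have "\<dots> \<le> nu * ((1 + a) * (5 / 2 * \<phi> * ?r) + a * (\<phi> * ?r) * 1) + 2 * \<phi> * ?r"
  proof -
    have "\<bar>h (u 0)\<bar> * \<bar>?p u - ?p v\<bar> \<le> (1 + a) * (5 / 2 * \<phi> * ?r)"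
      by (rule mult_mono) (use h_bounds[OF u[of 0]] a_pos p in auto)
    moreover have "\<bar>h (u 0) - h (v 0)\<bar> * \<bar>?p v\<bar> \<le> a * (\<phi> * ?r) * 1"
      by (rule mult_mono) (use h0 pv a_pos \<phi> in auto)
    ultimately show ?thesis
      by (rule add_mono[OF mult_left_mono[OF add_mono] m]) (use nu_pos in simp)
  qed
  also have "\<dots> = lip * \<phi> * ?r"
    by (simp add: lip_def algebra_simps)
  finally show ?thesis .
qed

text \<open>Uniformity in \<open>k\<close> gives all coordinates of a solution a common modulus of
  continuity.\<close>

lemma rhs_bound:
  assumes u: "\<And>k. u k \<in> {0..1}"
  shows "\<bar>rhs u k\<bar> \<le> nu * (1 + a) + 1"
proof -
  let ?p = "u (Suc k) - (if k = 0 then 0 else u k)"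
  let ?m = "(if k = 0 then 0 else u (k - 1)) - u k"
  have "\<bar>?p\<bar> \<le> 1" "\<bar>?m\<bar> \<le> 1"
    using u[of k] u[of "Suc k"] u[of "k - 1"] by (auto simp: abs_if)
  moreover have "\<bar>nu * h (u 0) * ?p\<bar> = nu * h (u 0) * \<bar>?p\<bar>"
    using nu_pos h_bounds[OF u[of 0]] by (simp add: abs_mult)
  moreover have "nu * h (u 0) * \<bar>?p\<bar> \<le> nu * (1 + a) * 1"
    using nu_pos h_bounds[OF u[of 0]] a_pos \<open>\<bar>?p\<bar> \<le> 1\<close> by (intro mult_mono) auto
  ultimately show ?thesis
    unfolding rhs_def by linarith
qed

text \<open>Makes the Picard iteration below close exactly: integrating \<open>L * \<phi> n\<close>
  there yields \<open>\<phi> (n + 1)\<close> up to the initial value.\<close>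

lemma exp_taylor_deriv:
  fixes L E :: real
  shows "((\<lambda>s. E * exp (L * s) + (L * s) ^ Suc n / fact (Suc n)) has_real_derivative
          L * (E * exp (L * s) + (L * s) ^ n / fact n)) (at s within S)"
  by (rule derivative_eq_intros refl | simp)+ (simp add: field_simps del: of_nat_Suc)

text \<open>
  Gronwall's lemma by Picard iteration: an a priori bound \<open>\<phi> n t * (3/2)^k\<close> on all coordinates
  improves to \<open>\<phi> (n + 1) t * (3/2)^k\<close> after integration, and the remainder \<open>(L t)^n / n!\<close> vanishes.
\<close>

theorem stability:
  assumes u: "approx_solution T E u" and v: "approx_solution T E v"
    and init: "\<And>k. \<bar>u 0 k - v 0 k\<bar> \<le> E * (3 / 2) ^ k"
    and t: "t \<in> {0..T}"
  shows "\<bar>u t k - v t k\<bar> \<le> E * exp ((lip + 2) * t) * (3 / 2) ^ k"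
proof -
  \<comment> \<open>\<open>lip\<close> accounts for the Lipschitz term and \<open>2\<close> for the
    two defects, each of them at most \<open>E <= \<phi> n\<close>.\<close>
  define L where "L = lip + 2"
  define \<phi> where "\<phi> n t = E * exp (L * t) + (L * t) ^ n / fact n" for n t
  have E: "0 \<le> E" using init[of 0] by simp
  have L: "0 < L" "lip \<le> L" using lip_pos by (auto simp: L_def)
  have u01: "u t k \<in> {0..1}" and v01: "v t k \<in> {0..1}" if "t \<in> {0..T}" for t k
    using u v that by (auto simp: approx_solution_def)
  obtain Du Dv where
    Du: "\<And>t k. t \<in> {0..T} \<Longrightarrow> ((\<lambda>s. u s k) has_real_derivative Du t k) (at t within {0..})"
        "\<And>t k. t \<in> {0..T} \<Longrightarrow> \<bar>Du t k - rhs (u t) k\<bar> \<le> E * (3 / 2) ^ k" and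
    Dv: "\<And>t k. t \<in> {0..T} \<Longrightarrow> ((\<lambda>s. v s k) has_real_derivative Dv t k) (at t within {0..})"
        "\<And>t k. t \<in> {0..T} \<Longrightarrow> \<bar>Dv t k - rhs (v t) k\<bar> \<le> E * (3 / 2) ^ k"
    using u v unfolding approx_solution_def by metis
  have *: "\<bar>u t k - v t k\<bar> \<le> \<phi> n t * (3 / 2) ^ k" if "t \<in> {0..T}" for n t k
    using that
  proof (induction n arbitrary: t k)
    \<comment> \<open>The iteration can start because both values lie in \<open>[0, 1]\<close> and
      the remainder for \<open>n = 0\<close> equals 1.\<close>
    case 0
    have "\<bar>u t k - v t k\<bar> \<le> 1" using u01[OF 0, of k] v01[OF 0, of k] by auto
    moreover have "1 * 1 \<le> \<phi> 0 t * (3 / 2) ^ k"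
      using E by (intro mult_mono) (auto simp: \<phi>_def)
    ultimately show ?case by linarith
  next
    case (Suc n)
    let ?r = "(3 / 2) ^ k :: real"
    have deriv: "\<bar>Du s k - Dv s k\<bar> \<le> L * \<phi> n s * ?r" if s: "s \<in> {0..t}" for s
    proof -
      have sT: "s \<in> {0..T}" using s Suc.prems by auto
      have "E * 1 \<le> E * exp (L * s)"
        using E L s by (intro mult_left_mono) auto
      moreover have "0 \<le> (L * s) ^ n / fact n" using L s by simp
      ultimately have "E \<le> \<phi> n s" by (simp add: \<phi>_def)
      then have "E * ?r \<le> \<phi> n s * ?r" by simp
      moreover have "\<bar>rhs (u s) k - rhs (v s) k\<bar> \<le> lip * \<phi> n s * ?r"
        using Suc.IH sT u01 v01 by (intro rhs_lipschitz) auto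
      ultimately show ?thesis
        using Du(2)[OF sT, of k] Dv(2)[OF sT, of k] unfolding L_def distrib_right
        by linarith
    qed
    have g: "((\<lambda>s. \<phi> (Suc n) s * ?r) has_real_derivative L * \<phi> n s * ?r) (at s within {0..})" for s
      unfolding \<phi>_def by (intro DERIV_cmult_right exp_taylor_deriv)
    have sub: "s \<in> {0..T}" if "s \<in> {0..t}" for s using that Suc.prems by auto
    have init': "\<bar>u 0 k - v 0 k\<bar> \<le> \<phi> (Suc n) 0 * ?r"
      using init[of k] by (simp add: \<phi>_def)
    \<comment> \<open>The two signs are compared separately, since the absolute value of a
      difference need not be differentiable.\<close>
    have "u t k - v t k \<le> \<phi> (Suc n) t * ?r"
      by (rule le_if_deriv_le[OF _ DERIV_diff[OF Du(1) Dv(1)] g])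
         (use sub deriv Suc.prems init' in \<open>auto simp: abs_le_iff\<close>)
    moreover have "v t k - u t k \<le> \<phi> (Suc n) t * ?r"
      by (rule le_if_deriv_le[OF _ DERIV_diff[OF Dv(1) Du(1)] g])
         (use sub deriv Suc.prems init' in \<open>auto simp: abs_le_iff\<close>)
    ultimately show ?case by linarith
  qed
  have "(\<lambda>n. \<phi> n t * (3 / 2) ^ k) \<longlonglongrightarrow> (E * exp (L * t) + 0) * (3 / 2) ^ k"
    unfolding \<phi>_def
    using summable_LIMSEQ_zero[OF summable_exp, of "L * t"]
    by (intro tendsto_intros) (simp add: field_simps)
  from LIMSEQ_le_const[OF this] *[OF t] show ?thesis
    unfolding L_def by auto
qed

end

section \<open>Comparison of the geometric weights with \<open>wnorm\<close>\<close>

lemma weighted_le_geometric: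
  fixes c :: real
  assumes "b \<le> c * (3 / 2) ^ k"
  shows "b / 2 ^ k \<le> c * (3 / 4) ^ k"
proof -
  have "(3 / 4 :: real) ^ k = (3 / 2) ^ k / 2 ^ k"
    by (simp flip: power_divide)
  then show ?thesis
    using divide_right_mono[OF assms, of "2 ^ k"] by simp
qed

lemma wnorm_summable:
  fixes z :: "nat \<Rightarrow> real"
  assumes "\<And>k. \<bar>z k\<bar> \<le> c * (3 / 2) ^ k"
  shows "summable (\<lambda>k. \<bar>z k\<bar> / 2 ^ k)"
proof (rule summable_comparison_test)
  show "\<exists>N. \<forall>k\<ge>N. norm (\<bar>z k\<bar> / 2 ^ k) \<le> c * (3 / 4) ^ k"
    using weighted_le_geometric[OF assms] by auto
  show "summable (\<lambda>k. c * (3 / 4 :: real) ^ k)"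
    by (intro summable_mult summable_geometric) simp
qed

lemma wnorm_nonneg:
  assumes "\<And>k. \<bar>z k\<bar> \<le> c * (3 / 2) ^ k"
  shows "0 \<le> wnorm z"
  unfolding wnorm_def by (intro suminf_nonneg wnorm_summable[OF assms]) auto

text \<open>The factor 4 is the sum of the geometric series with ratio \<open>3/4\<close>, the
  quotient of \<open>3/2\<close> and 2.\<close>

lemma wnorm_le:
  assumes "\<And>k. \<bar>z k\<bar> \<le> c * (3 / 2) ^ k"
  shows "wnorm z \<le> 4 * c"
proof -
  have "(\<lambda>k. c * (3 / 4 :: real) ^ k) sums (c * (1 / (1 - 3 / 4)))"
    by (intro sums_mult geometric_sums) simp
  from sums_le[OF weighted_le_geometric[OF assms] summable_sums[OF wnorm_summable[OF assms]] this]
  show ?thesis by (simp add: wnorm_def)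
qed

lemma abs_le_wnorm:
  assumes "\<And>k. \<bar>z k\<bar> \<le> c * (3 / 2) ^ k"
  shows "\<bar>z k\<bar> \<le> 2 ^ k * wnorm z"
proof -
  have "(\<Sum>i\<in>{k}. \<bar>z i\<bar> / 2 ^ i) \<le> wnorm z"
    unfolding wnorm_def by (intro sum_le_suminf wnorm_summable[OF assms]) auto
  then show ?thesis by (simp add: field_simps)
qed

text \<open>Converse to \<open>wnorm_le\<close> for uniformly bounded sequences. Far coordinates
  satisfy the bound for free once the weight exceeds \<open>1 / \<epsilon>\<close>; the finitely
  many others are controlled by the norm at the cost of a factor \<open>2 ^ K\<close>.\<close>

lemma eventually_le_geometric:
  assumes bnd: "\<And>n k. \<bar>z n k\<bar> \<le> (1 :: real)"
    and lim: "(\<lambda>n. wnorm (z n)) \<longlonglongrightarrow> 0" and "0 < \<epsilon>"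
  shows "\<forall>\<^sub>F n in sequentially. \<forall>k. \<bar>z n k\<bar> \<le> \<epsilon> * (3 / 2) ^ k"
proof -
  have bnd': "\<bar>z n k\<bar> \<le> 1 * (3 / 2) ^ k" for n k
    using bnd[of n k] one_le_power[of "3 / 2 :: real" k] by linarith
  obtain K where K: "1 / \<epsilon> < (3 / 2 :: real) ^ K"
    using real_arch_pow[of "3 / 2 :: real"] by auto
  have "\<forall>\<^sub>F n in sequentially. wnorm (z n) < \<epsilon> / 2 ^ K"
    using lim \<open>0 < \<epsilon>\<close> by (intro order_tendstoD) auto
  then show ?thesis
  proof eventually_elim
    case (elim n)
    show ?case
    proof
      fix k
      show "\<bar>z n k\<bar> \<le> \<epsilon> * (3 / 2) ^ k"
      proof (cases "k \<le> K")
        case True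
        have "\<bar>z n k\<bar> \<le> 2 ^ k * wnorm (z n)" by (rule abs_le_wnorm[OF bnd'])
        also have "\<dots> \<le> 2 ^ K * wnorm (z n)"
          using True by (intro mult_right_mono power_increasing wnorm_nonneg[OF bnd']) auto
        also have "\<dots> \<le> \<epsilon> * 1" using elim by (simp add: field_simps)
        also have "\<dots> \<le> \<epsilon> * (3 / 2) ^ k" using \<open>0 < \<epsilon>\<close> by (intro mult_left_mono) auto
        finally show ?thesis .
      next
        case False
        then have "(3 / 2 :: real) ^ K \<le> (3 / 2) ^ k" by (intro power_increasing) auto
        with K have "1 / \<epsilon> \<le> (3 / 2) ^ k" by linarith
        then have "1 \<le> \<epsilon> * (3 / 2) ^ k" using \<open>0 < \<epsilon>\<close> by (simp add: field_simps)
        with bnd[of n k] show ?thesis by linarith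
      qed
    qed
  qed
qed

section \<open>The finite system as a perturbation of the limit system\<close>

context logistic_rate
begin

lemma approx_solution_mono:
  assumes "approx_solution T \<delta> u" "\<delta> \<le> \<delta>'"
  shows "approx_solution T \<delta>' u"
  unfolding approx_solution_def
proof (intro ballI allI)
  fix t k assume "t \<in> {0..T}"
  moreover have "\<delta> * (3 / 2) ^ k \<le> \<delta>' * (3 / 2 :: real) ^ k"
    using assms(2) by (intro mult_right_mono) auto
  ultimately show "u t k \<in> {0..1} \<and>
     (\<exists>D. ((\<lambda>s. u s k) has_real_derivative D) (at t within {0..}) \<and>
          \<bar>D - rhs (u t) k\<bar> \<le> \<delta>' * (3 / 2) ^ k)"
    using assms(1) unfolding approx_solution_def by (meson order_trans)
qed

text \<open>Exchanges inside \<open>{0..K}\<close> cancel, leaving only the flow between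
  \<open>K\<close> and \<open>K + 1\<close>. This governs the conservation of mass.\<close>

lemma sum_rhs: "(\<Sum>k\<le>K. rhs z k) = nu * h (z 0) * z (Suc K) - z K"
  by (induction K) (auto simp: rhs_def algebra_simps)

lemma limit_system_iff:
  "limit_system h nu G \<longleftrightarrow>
    (\<forall>t\<ge>0. \<forall>k. ((\<lambda>s. pmf (G s) k) has_real_derivative rhs (pmf (G t)) k) (at t within {0..}))"
proof -
  have "(\<forall>k. P k) \<longleftrightarrow> P 0 \<and> (\<forall>k\<ge>1. P k)" for P :: "nat \<Rightarrow> bool"
    by (metis less_one not_le)
  note split = this
  have 0: "nu * h (pmf (G t) 0) * pmf (G t) 1 - pmf (G t) 0 = rhs (pmf (G t)) 0" for t
    by (simp add: rhs_def)
  have Suc: "nu * h (pmf (G t) 0) * pmf (G t) (k + 1) + pmf (G t) (k - 1)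
               - (nu * h (pmf (G t) 0) + 1) * pmf (G t) k = rhs (pmf (G t)) k" if "k \<ge> 1" for t k
    using that by (simp add: rhs_def algebra_simps)
  show ?thesis
    unfolding limit_system_def by (subst split) (auto simp: 0 Suc simp del: One_nat_def)
qed

text \<open>
  The error of the reflected process as a solution of the limit system is
  \<open>e = (k y\<^sub>k - (k - 1) y\<^sub>k\<^sub>-\<^sub>1) / C\<close>; this formula is also valid at the boundary \<open>k = C\<close> and
  beyond it.
\<close>

lemma DAR_rescaled:
  assumes C: "C \<ge> 1" and DAR: "DAR h (nu * real C) C x"
  shows "approx_solution T (2 / real C) (\<lambda>t. reflect C (x (t / real C)))"
  unfolding approx_solution_def
proof (intro ballI allI conjI)
  fix t k assume t: "t \<in> {0..T}"
  let ?y = "\<lambda>t. reflect C (x (t / real C))"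
  show 01: "?y t k \<in> {0..1}" for t k
    by (simp add: reflect_def pmf_le_1)
  \<comment> \<open>For \<open>k = 0\<close> truncated subtraction turns \<open>k - 1\<close> into
    0, but the factor \<open>real (k - 1)\<close> then removes that term.\<close>
  define e where "e = (real k * ?y t k - real (k - 1) * ?y t (k - 1)) / C"
  have "\<bar>real k * ?y t k - real (k - 1) * ?y t (k - 1)\<bar> \<le> real k"
  proof -
    have "0 \<le> real k * ?y t k" "real k * ?y t k \<le> real k * 1"
         "0 \<le> real (k - 1) * ?y t (k - 1)" "real (k - 1) * ?y t (k - 1) \<le> real (k - 1) * 1"
      using 01 by (auto intro!: mult_left_mono simp del: mult_1_right)
    then show ?thesis by (auto simp: abs_le_iff)
  qed
  \<comment> \<open>Bernoulli's inequality for \<open>(1 + 1/2) ^ k\<close> absorbs the linear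
    growth into the weight; it is the source of the 2 in the defect \<open>2 / C\<close>.\<close>
  moreover have "real k \<le> 2 * (3 / 2) ^ k"
    using Bernoulli_inequality[of "1 / 2 :: real" k] by simp
  ultimately have "\<bar>real k * ?y t k - real (k - 1) * ?y t (k - 1)\<bar> / C \<le> 2 * (3 / 2) ^ k / C"
    by (intro divide_right_mono) auto
  then have e: "\<bar>e\<bar> \<le> 2 / C * (3 / 2) ^ k"
    by (simp only: e_def abs_divide abs_of_nat times_divide_eq_left)
  have s: "t / C \<ge> 0" using t by simp
  have deriv: "((\<lambda>s. pmf (x s) j) has_real_derivative
      C * (rhs (?y t) k + e)) (at (t / C) within {0..})" if k: "k \<le> C" "j = C - k" for j
  proof -
    have "k = 0 \<or> (1 \<le> j \<and> j < C) \<or> k = C" using k by linarith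
    then consider "k = 0" "j = C" | "k = C" "j = 0" "C > 0" | "1 \<le> j" "j < C" "k = C - j" "k \<ge> 1"
      using k C by force
    then show ?thesis
    proof cases
      case 1
      have "((\<lambda>s. pmf (x s) C) has_real_derivative
         nu * C * h (pmf (x (t / C)) C) * pmf (x (t / C)) (C - 1) - real C * pmf (x (t / C)) C) (at (t / C) within {0..})"
        using DAR s unfolding DAR_def by blast
      then show ?thesis
        unfolding 1(2) by (rule DERIV_cong) (use 1 C in \<open>simp add: rhs_def e_def reflect_def algebra_simps\<close>)
    next
      case 2
      have "((\<lambda>s. pmf (x s) 0) has_real_derivative
         pmf (x (t / C)) 1 - nu * C * h (pmf (x (t / C)) C) * pmf (x (t / C)) 0) (at (t / C) within {0..})"
        using DAR s unfolding DAR_def by blast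
      then show ?thesis
        unfolding 2(2) by (rule DERIV_cong) (use 2 C in \<open>simp add: rhs_def e_def reflect_def field_simps of_nat_diff\<close>)
    next
      case 3
      have "((\<lambda>s. pmf (x s) j) has_real_derivative
           nu * C * h (pmf (x (t / C)) C) * pmf (x (t / C)) (j - 1) + real (j + 1) * pmf (x (t / C)) (j + 1)
             - (nu * C * h (pmf (x (t / C)) C) + real j) * pmf (x (t / C)) j) (at (t / C) within {0..})"
        using DAR s 3 unfolding DAR_def by blast
      moreover have "?y t (Suc k) = pmf (x (t / C)) (j - 1)" "?y t (k - 1) = pmf (x (t / C)) (j + 1)"
        "?y t k = pmf (x (t / C)) j" "?y t 0 = pmf (x (t / C)) C" "real k = real C - real j"
        using 3 by (auto simp: reflect_def of_nat_diff intro!: arg_cong[where f = "pmf (x (t / C))"])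
      ultimately show ?thesis
        by (elim DERIV_cong) (use 3 C in \<open>simp add: rhs_def e_def field_simps of_nat_diff\<close>)
    qed
  qed
  have "((\<lambda>s. ?y s k) has_real_derivative (rhs (?y t) k + e)) (at t within {0..})"
  proof (cases "k \<le> C")
    case True
    \<comment> \<open>The time change contributes \<open>1 / C\<close>, which cancels the factor
      \<open>C\<close> of the unscaled derivative.\<close>
    have "((\<lambda>s. pmf (x s) (C - k)) \<circ> (\<lambda>s. s / C) has_real_derivative
        C * (rhs (?y t) k + e) * (1 / C)) (at t within {0..})"
      by (rule DERIV_image_chain[OF DERIV_subset[OF deriv[OF True refl]] DERIV_cdivide[OF DERIV_ident]]) auto
    then show ?thesis using True C by (simp add: reflect_def o_def)
  next
    case False
    \<comment> \<open>At \<open>k = C + 1\<close> the inflow from coordinate \<open>C\<close> is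
      cancelled by \<open>e\<close>; further out every term is zero.\<close>
    then have "rhs (?y t) k + e = 0"
      using C by (cases "k = Suc C") (auto simp: rhs_def e_def reflect_def)
    then show ?thesis using False by (simp add: reflect_def)
  qed
  with e show "\<exists>D. ((\<lambda>s. ?y s k) has_real_derivative D) (at t within {0..}) \<and>
          \<bar>D - rhs (?y t) k\<bar> \<le> 2 / real C * (3 / 2) ^ k"
    by (intro exI[of _ "rhs (?y t) k + e"]) auto
qed

end

section \<open>Construction of the limit from a scheme of approximate solutions\<close>

locale approximation_scheme = logistic_rate +
  fixes y :: "nat \<Rightarrow> real \<Rightarrow> nat \<Rightarrow> real" and \<delta> :: "nat \<Rightarrow> real" and q :: "nat \<Rightarrow> real"
  assumes approx: "approx_solution T (\<delta> n) (y n)"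
    and \<delta>_lim: "\<delta> \<longlonglongrightarrow> 0"
    and init: "0 < \<epsilon> \<Longrightarrow> \<forall>\<^sub>F n in sequentially. \<forall>k. \<bar>y n 0 k - q k\<bar> \<le> \<epsilon> * (3 / 2) ^ k"
    and q_sums: "q sums 1"
    and mass_le: "0 \<le> t \<Longrightarrow> (\<Sum>k\<le>K. y n t k) \<le> 1"
begin

definition \<Gamma> :: "real \<Rightarrow> nat \<Rightarrow> real" where
  "\<Gamma> t k = lim (\<lambda>n. y n t k)"

lemma y01: "0 \<le> t \<Longrightarrow> y n t k \<in> {0..1}"
  using approx[of t n] by (auto simp: approx_solution_def)

lemma uniformly_cauchy:
  assumes "0 < \<epsilon>"
  shows "\<exists>N. \<forall>m\<ge>N. \<forall>n\<ge>N. \<forall>t\<in>{0..T}. \<forall>k. \<bar>y m t k - y n t k\<bar> \<le> \<epsilon> * (3 / 2) ^ k"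
proof -
  \<comment> \<open>Chosen so that the Gronwall factor at time \<open>T\<close> turns
    \<open>E\<close> into \<open>\<epsilon>\<close>.\<close>
  define E where "E = \<epsilon> * exp (- ((lip + 2) * T))"
  have E: "0 < E" using assms by (simp add: E_def)
  have "\<forall>\<^sub>F n in sequentially. \<delta> n < E"
    using \<delta>_lim E by (rule order_tendstoD)
  \<comment> \<open>Half of \<open>E\<close> each, since two members are compared at time 0 through
    \<open>q\<close>.\<close>
  moreover have "\<forall>\<^sub>F n in sequentially. \<forall>k. \<bar>y n 0 k - q k\<bar> \<le> E / 2 * (3 / 2) ^ k"
    using E by (intro init) simp
  ultimately have "\<forall>\<^sub>F n in sequentially. \<delta> n < E \<and> (\<forall>k. \<bar>y n 0 k - q k\<bar> \<le> E / 2 * (3 / 2) ^ k)"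
    by (rule eventually_conj)
  then obtain N where N: "\<And>n. n \<ge> N \<Longrightarrow> \<delta> n < E"
    "\<And>n k. n \<ge> N \<Longrightarrow> \<bar>y n 0 k - q k\<bar> \<le> E / 2 * (3 / 2) ^ k"
    unfolding eventually_sequentially by auto
  have "\<bar>y m t k - y n t k\<bar> \<le> \<epsilon> * (3 / 2) ^ k" if "m \<ge> N" "n \<ge> N" and t: "t \<in> {0..T}" for m n t k
  proof -
    have "\<bar>y m 0 k - y n 0 k\<bar> \<le> E * (3 / 2) ^ k" for k
      using N(2)[OF that(1), of k] N(2)[OF that(2), of k] by linarith
    then have bound: "\<bar>y m t k - y n t k\<bar> \<le> E * exp ((lip + 2) * t) * (3 / 2) ^ k"
      using N(1) that by (intro stability[of T] approx_solution_mono[OF approx]) (auto simp: less_imp_le)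
    have "E * exp ((lip + 2) * T) = \<epsilon>"
      by (simp add: E_def exp_minus)
    moreover have "E * exp ((lip + 2) * t) \<le> E * exp ((lip + 2) * T)"
      using E t lip_pos by (intro mult_left_mono) auto
    ultimately have "E * exp ((lip + 2) * t) \<le> \<epsilon>" by linarith
    then have "E * exp ((lip + 2) * t) * (3 / 2) ^ k \<le> \<epsilon> * (3 / 2) ^ k"
      by (rule mult_right_mono) simp
    with bound show ?thesis by linarith
  qed
  then show ?thesis by blast
qed

lemma tendsto_\<Gamma>:
  assumes "0 \<le> t"
  shows "(\<lambda>n. y n t k) \<longlonglongrightarrow> \<Gamma> t k"
proof -
  have "Cauchy (\<lambda>n. y n t k)"
  proof (rule metric_CauchyI)
    fix e :: real assume "0 < e"
    then have "0 < e / (2 * (3 / 2) ^ k)" by simp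
    then obtain N where N: "\<And>m n s j. m \<ge> N \<Longrightarrow> n \<ge> N \<Longrightarrow> s \<in> {0..t} \<Longrightarrow>
        \<bar>y m s j - y n s j\<bar> \<le> e / (2 * (3 / 2) ^ k) * (3 / 2) ^ j"
      using uniformly_cauchy[of "e / (2 * (3 / 2) ^ k)" t] by blast
    have "\<bar>y m t k - y n t k\<bar> < e" if "m \<ge> N" "n \<ge> N" for m n
      using N[OF that, of t k] assms \<open>0 < e\<close> by simp
    then show "\<exists>N. \<forall>m\<ge>N. \<forall>n\<ge>N. dist (y m t k) (y n t k) < e"
      by (auto simp: dist_real_def)
  qed
  then show ?thesis
    unfolding \<Gamma>_def by (simp add: Cauchy_convergent_iff convergent_LIMSEQ_iff)
qed

text \<open>Follows by letting \<open>m\<close> tend to infinity in the Cauchy estimate, whose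
  \<open>N\<close> depends on neither \<open>t\<close> nor \<open>k\<close>.\<close>

lemma uniform_\<Gamma>:
  assumes "0 < \<epsilon>"
  shows "\<forall>\<^sub>F n in sequentially. \<forall>t\<in>{0..T}. \<forall>k. \<bar>y n t k - \<Gamma> t k\<bar> \<le> \<epsilon> * (3 / 2) ^ k"
proof -
  obtain N where N: "\<And>m n t k. m \<ge> N \<Longrightarrow> n \<ge> N \<Longrightarrow> t \<in> {0..T} \<Longrightarrow>
      \<bar>y m t k - y n t k\<bar> \<le> \<epsilon> * (3 / 2) ^ k"
    using uniformly_cauchy[OF assms, of T] by blast
  have "\<bar>y n t k - \<Gamma> t k\<bar> \<le> \<epsilon> * (3 / 2) ^ k" if "n \<ge> N" "t \<in> {0..T}" for n t k
  proof (rule LIMSEQ_le_const2)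
    show "(\<lambda>m. \<bar>y n t k - y m t k\<bar>) \<longlonglongrightarrow> \<bar>y n t k - \<Gamma> t k\<bar>"
      using that by (intro tendsto_intros tendsto_\<Gamma>) auto
    show "\<exists>M. \<forall>m\<ge>M. \<bar>y n t k - y m t k\<bar> \<le> \<epsilon> * (3 / 2) ^ k"
      using N that by blast
  qed
  then show ?thesis unfolding eventually_sequentially by blast
qed

lemma \<Gamma>01:
  assumes "0 \<le> t"
  shows "\<Gamma> t k \<in> {0..1}"
proof -
  have "0 \<le> \<Gamma> t k"
    by (rule LIMSEQ_le_const[OF tendsto_\<Gamma>[OF assms]]) (use y01[OF assms] in auto)
  moreover have "\<Gamma> t k \<le> 1"
    by (rule LIMSEQ_le_const2[OF tendsto_\<Gamma>[OF assms]]) (use y01[OF assms] in auto)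
  ultimately show ?thesis by simp
qed

lemma \<Gamma>_init: "\<Gamma> 0 k = q k"
proof (rule LIMSEQ_unique[OF tendsto_\<Gamma>])
  show "(\<lambda>n. y n 0 k) \<longlonglongrightarrow> q k"
  proof (rule tendstoI)
    fix e :: real assume "0 < e"
    then have "\<forall>\<^sub>F n in sequentially. \<forall>j. \<bar>y n 0 j - q j\<bar> \<le> e / (2 * (3 / 2) ^ k) * (3 / 2) ^ j"
      by (intro init) simp
    then show "\<forall>\<^sub>F n in sequentially. dist (y n 0 k) (q k) < e"
    proof eventually_elim
      case (elim n)
      then have "\<bar>y n 0 k - q k\<bar> \<le> e / (2 * (3 / 2) ^ k) * (3 / 2) ^ k" by blast
      then show ?case using \<open>0 < e\<close> by (simp add: dist_real_def)
    qed
  qed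
qed simp

lemma \<Gamma>_mass_le: "0 \<le> t \<Longrightarrow> (\<Sum>k\<le>K. \<Gamma> t k) \<le> 1"
  by (rule LIMSEQ_le_const2[OF tendsto_sum[OF tendsto_\<Gamma>]]) (use mass_le in auto)

text \<open>By the Lipschitz estimate and the vanishing defects, the derivatives converge uniformly
  on compact time intervals, so limit and derivative may be exchanged.\<close>

lemma \<Gamma>_deriv:
  assumes t: "0 \<le> t"
  shows "((\<lambda>s. \<Gamma> s k) has_real_derivative rhs (\<Gamma> t) k) (at t within {0..})"
proof -
  \<comment> \<open>Reaching beyond \<open>t\<close> makes this interval a neighbourhood of
    \<open>t\<close> in the half-line, so that derivatives at \<open>t\<close> within either set
    coincide.\<close>
  let ?S = "{0..t + 1}"
  have "\<forall>n. \<forall>s\<in>?S. \<exists>D. ((\<lambda>s. y n s k) has_real_derivative D) (at s within {0..}) \<and>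
      \<bar>D - rhs (y n s) k\<bar> \<le> \<delta> n * (3 / 2) ^ k"
    using approx[of "t + 1"] unfolding approx_solution_def by blast
  then obtain D where D: "\<And>n s. s \<in> ?S \<Longrightarrow> ((\<lambda>s. y n s k) has_real_derivative D n s) (at s within {0..})"
      "\<And>n s. s \<in> ?S \<Longrightarrow> \<bar>D n s - rhs (y n s) k\<bar> \<le> \<delta> n * (3 / 2) ^ k"
    unfolding bchoice_iff choice_iff by blast
  have "\<exists>g. \<forall>s\<in>?S. (\<lambda>n. y n s k) \<longlonglongrightarrow> g s \<and> (g has_derivative (*) (rhs (\<Gamma> s) k)) (at s within ?S)"
  proof (rule has_derivative_sequence)
    show "((\<lambda>s. y n s k) has_derivative (*) (D n s)) (at s within ?S)" if "s \<in> ?S" for n s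
      using DERIV_subset[OF D(1)[OF that], of ?S] by (auto simp: has_field_derivative_def)
    show "\<forall>\<^sub>F n in sequentially. \<forall>s\<in>?S. \<forall>x. norm (D n s * x - rhs (\<Gamma> s) k * x) \<le> e * norm x"
      if "e > 0" for e
    proof -
      \<comment> \<open>\<open>lip * \<epsilon>\<close> is spent on replacing \<open>y n\<close> by
        \<open>\<Gamma>\<close> in \<open>rhs\<close>, and one more \<open>\<epsilon>\<close> on the
        defect \<open>\<delta> n\<close>.\<close>
      define \<epsilon> where "\<epsilon> = e / ((lip + 1) * (3 / 2) ^ k)"
      have \<epsilon>: "0 < \<epsilon>" and e: "(lip + 1) * \<epsilon> * (3 / 2) ^ k = e"
        using that lip_pos by (auto simp: \<epsilon>_def)
      have "\<forall>\<^sub>F n in sequentially. \<delta> n < \<epsilon>"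
        using \<delta>_lim \<epsilon> by (rule order_tendstoD)
      then show ?thesis
        using uniform_\<Gamma>[OF \<epsilon>, of "t + 1"]
      proof eventually_elim
        case (elim n)
        show ?case
        proof (intro ballI allI)
          fix s x assume s: "s \<in> ?S"
          have "\<bar>rhs (y n s) k - rhs (\<Gamma> s) k\<bar> \<le> lip * \<epsilon> * (3 / 2) ^ k"
            using elim s by (intro rhs_lipschitz y01 \<Gamma>01) auto
          moreover have "\<delta> n * (3 / 2) ^ k \<le> \<epsilon> * (3 / 2) ^ k"
            using elim by simp
          ultimately have "\<bar>D n s - rhs (\<Gamma> s) k\<bar> \<le> e"
            using D(2)[OF s, of n] e unfolding distrib_right by linarith
          then have "\<bar>D n s - rhs (\<Gamma> s) k\<bar> * \<bar>x\<bar> \<le> e * \<bar>x\<bar>"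
            by (intro mult_right_mono) auto
          then show "norm (D n s * x - rhs (\<Gamma> s) k * x) \<le> e * norm x"
            by (simp flip: abs_mult left_diff_distrib)
        qed
      qed
    qed
    show "(\<lambda>n. y n 0 k) \<longlonglongrightarrow> \<Gamma> 0 k" by (rule tendsto_\<Gamma>) simp
  qed (use t in auto)
  then obtain g where "\<forall>s\<in>?S. (\<lambda>n. y n s k) \<longlonglongrightarrow> g s \<and>
      (g has_derivative (*) (rhs (\<Gamma> s) k)) (at s within ?S)" by blast
  then have g: "(\<lambda>n. y n s k) \<longlonglongrightarrow> g s" "(g has_real_derivative rhs (\<Gamma> s) k) (at s within ?S)"
    if "s \<in> ?S" for s
    using that by (simp_all add: has_field_derivative_def)
  have eq: "g s = \<Gamma> s k" if "s \<in> ?S" for s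
    using LIMSEQ_unique[OF g(1)[OF that] tendsto_\<Gamma>] that by auto
  have "((\<lambda>s. \<Gamma> s k) has_real_derivative rhs (\<Gamma> t) k) (at t within ?S)"
    by (rule has_field_derivative_transform_within[OF g(2) zero_less_one]) (use t eq in auto)
  moreover have "at t within ?S = at t within {0..}"
    using t by (intro at_within_nhd[of t "{..<t + 1}"]) auto
  ultimately show ?thesis by simp
qed

text \<open>
  The partial sum \<open>S K\<close> of \<open>\<Gamma>\<close> has derivative \<open>\<nu> h(\<Gamma>\<^sub>0) \<Gamma>\<^sub>K\<^sub>+\<^sub>1 - \<Gamma>\<^sub>K\<close>. Summed over \<open>n \<le> K < 2 n\<close>
  this is bounded uniformly in \<open>n\<close>, so the average of these \<open>n\<close> partial sums moves by only
  \<open>O(1/n)\<close> and no mass escapes to infinity.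
\<close>

lemma \<Gamma>_sums:
  assumes t: "0 \<le> t"
  shows "\<Gamma> t sums 1"
proof -
  define S where "S K s = (\<Sum>k\<le>K. \<Gamma> s k)" for K s
  define M where "M = nu * (1 + a) + 1"
  have S_mono: "S K s \<le> S K' s" if "0 \<le> s" "K \<le> K'" for K K' s
    unfolding S_def using that \<Gamma>01 by (intro sum_mono2) auto
  have lower: "S n 0 - M * t / n \<le> S (2 * n) t" if n: "n > 0" for n
  proof -
    define B where "B s = (\<Sum>K\<in>{n..<2 * n}. S K s)" for s
    have dB: "(B has_real_derivative (\<Sum>K\<in>{n..<2 * n}. nu * h (\<Gamma> s 0) * \<Gamma> s (Suc K) - \<Gamma> s K))
        (at s within {0..})" if "0 \<le> s" for s
      unfolding B_def S_def sum_rhs[symmetric] using that by (intro DERIV_sum \<Gamma>_deriv)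
    have bound: "\<bar>\<Sum>K\<in>{n..<2 * n}. nu * h (\<Gamma> s 0) * \<Gamma> s (Suc K) - \<Gamma> s K\<bar> \<le> M" if s: "0 \<le> s" for s
    proof -
      have part: "(\<Sum>K\<in>A. \<Gamma> s K) \<le> 1" "0 \<le> (\<Sum>K\<in>A. \<Gamma> s K)" if "A \<subseteq> {..2 * n}" for A
        using order_trans[OF sum_mono2[of "{..2 * n}" A "\<Gamma> s"] \<Gamma>_mass_le[OF s]] that \<Gamma>01[OF s]
        by (auto intro: sum_nonneg)
      \<comment> \<open>Both sums run over distinct indices, so each is at most 1 by
        \<open>\<Gamma>_mass_le\<close>, however large \<open>n\<close> is.\<close>
      define P where "P = (\<Sum>K\<in>{n..<2 * n}. \<Gamma> s (Suc K))"
      define Q where "Q = (\<Sum>K\<in>{n..<2 * n}. \<Gamma> s K)"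
      have "P = (\<Sum>K\<in>{Suc n..<Suc (2 * n)}. \<Gamma> s K)"
        unfolding P_def by (rule sum.shift_bounds_Suc_ivl[symmetric])
      moreover have "{Suc n..<Suc (2 * n)} \<subseteq> {..2 * n}" "{n..<2 * n} \<subseteq> {..2 * n}" by auto
      ultimately have P: "0 \<le> P" "P \<le> 1" and Q: "0 \<le> Q" "Q \<le> 1"
        using part by (simp_all only: Q_def)
      have "0 \<le> nu * h (\<Gamma> s 0) * P"
        using nu_pos h_bounds[OF \<Gamma>01[OF s]] P by simp
      moreover have "nu * h (\<Gamma> s 0) * P \<le> nu * (1 + a) * 1"
        using nu_pos h_bounds[OF \<Gamma>01[OF s]] P a_pos by (intro mult_mono) auto
      moreover have "(\<Sum>K\<in>{n..<2 * n}. nu * h (\<Gamma> s 0) * \<Gamma> s (Suc K) - \<Gamma> s K) = nu * h (\<Gamma> s 0) * P - Q"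
        by (simp add: sum_subtractf sum_distrib_left P_def Q_def)
      moreover have "0 \<le> nu * (1 + a)" using nu_pos a_pos by simp
      ultimately show ?thesis
        using Q unfolding M_def by linarith
    qed
    have "\<bar>B t - B 0\<bar> \<le> M * \<bar>t - 0\<bar>"
      by (rule abs_diff_le_if_deriv_le[OF dB bound]) (use t in auto)
    \<comment> \<open>\<open>S K\<close> increases with \<open>K\<close>, so the \<open>n\<close>
      terms of \<open>B\<close> can be bounded below by \<open>S n\<close> and above by
      \<open>S (2 * n)\<close>.\<close>
    moreover have "real n * S n 0 \<le> B 0"
      using sum_bounded_below[of "{n..<2 * n}" "S n 0" "\<lambda>K. S K 0"] S_mono by (simp add: B_def)
    moreover have "B t \<le> real n * S (2 * n) t"
      using sum_bounded_above[of "{n..<2 * n}" "\<lambda>K. S K t" "S (2 * n) t"] S_mono t by (simp add: B_def)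
    ultimately have "real n * S n 0 - M * t \<le> real n * S (2 * n) t"
      using t by auto
    then show ?thesis using n by (simp add: field_simps)
  qed
  have smono: "strict_mono (\<lambda>n :: nat. 2 * n)" by (auto simp: strict_mono_def)
  have summable: "summable (\<Gamma> t)"
    by (rule bounded_imp_summable[where B = 1]) (use \<Gamma>01[OF t] \<Gamma>_mass_le[OF t] in auto)
  have lim_t: "(\<lambda>n. S n t) \<longlonglongrightarrow> suminf (\<Gamma> t)"
    using summable_LIMSEQ'[OF summable] by (simp add: S_def)
  have "(\<lambda>n. S n 0 - M * t / n) \<longlonglongrightarrow> 1 - 0"
  proof (intro tendsto_diff)
    show "(\<lambda>n. S n 0) \<longlonglongrightarrow> 1"
      using q_sums by (simp add: S_def \<Gamma>_init sums_def_le)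
    show "(\<lambda>n. M * t / real n) \<longlonglongrightarrow> 0"
      by (rule lim_const_over_n)
  qed
  moreover have "(\<lambda>n. S (2 * n) t) \<longlonglongrightarrow> suminf (\<Gamma> t)"
    using LIMSEQ_subseq_LIMSEQ[OF lim_t smono] by (simp add: o_def)
  ultimately have "1 - 0 \<le> suminf (\<Gamma> t)"
    by (rule LIMSEQ_le) (use lower in \<open>auto intro!: exI[of _ 1]\<close>)
  moreover have "suminf (\<Gamma> t) \<le> 1"
    by (rule LIMSEQ_le_const2[OF lim_t]) (use \<Gamma>_mass_le[OF t] in \<open>auto simp: S_def\<close>)
  ultimately show ?thesis
    using summable_sums[OF summable] by auto
qed

text \<open>With \<open>max 0 t\<close>, \<open>embed_pmf\<close> receives a genuine distribution at
  negative times as well.\<close>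

definition path :: "real \<Rightarrow> nat pmf" where
  "path t = embed_pmf (\<Gamma> (max 0 t))"

lemma pmf_path:
  assumes "0 \<le> t"
  shows "pmf (path t) k = \<Gamma> t k"
proof -
  have "(\<integral>\<^sup>+k. ennreal (\<Gamma> t k) \<partial>count_space UNIV) = 1"
    using \<Gamma>01[OF assms] \<Gamma>_sums[OF assms]
    by (simp add: nn_integral_count_space_nat suminf_ennreal2 sums_iff)
  then show ?thesis
    using \<Gamma>01[OF assms] assms unfolding path_def by (subst pmf_embed_pmf) auto
qed

lemma limit_system_path: "limit_system h nu path"
  unfolding limit_system_iff
proof (intro allI impI)
  fix t k assume t: "(0 :: real) \<le> t"
  have "rhs (pmf (path t)) k = rhs (\<Gamma> t) k"
    using t by (simp add: rhs_def pmf_path)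
  moreover have "((\<lambda>s. pmf (path s) k) has_real_derivative rhs (\<Gamma> t) k) (at t within {0..})"
    by (rule has_field_derivative_transform_within[OF \<Gamma>_deriv[OF t] zero_less_one])
       (use t in \<open>auto simp: pmf_path\<close>)
  ultimately show "((\<lambda>s. pmf (path s) k) has_real_derivative rhs (pmf (path t)) k) (at t within {0..})"
    by simp
qed

lemma wnorm_upto_path:
  assumes "0 < T"
  shows "(\<lambda>n. wnorm_upto T (\<lambda>t k. y n t k - pmf (path t) k)) \<longlonglongrightarrow> 0"
proof (rule tendstoI)
  fix e :: real assume "0 < e"
  \<comment> \<open>\<open>wnorm_le\<close> multiplies by 4, so \<open>e / 8\<close> leaves
    \<open>e / 2\<close>, strictly below \<open>e\<close>.\<close>
  then have "\<forall>\<^sub>F n in sequentially. \<forall>t\<in>{0..T}. \<forall>k. \<bar>y n t k - \<Gamma> t k\<bar> \<le> e / 8 * (3 / 2) ^ k"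
    by (intro uniform_\<Gamma>) simp
  then show "\<forall>\<^sub>F n in sequentially. dist (wnorm_upto T (\<lambda>t k. y n t k - pmf (path t) k)) 0 < e"
  proof eventually_elim
    case (elim n)
    let ?z = "\<lambda>t k. y n t k - pmf (path t) k"
    have z: "\<bar>?z t k\<bar> \<le> e / 8 * (3 / 2) ^ k" if "t \<in> {0..T}" for t k
      using elim that by (auto simp: pmf_path)
    have le: "wnorm (?z t) \<le> 4 * (e / 8)" "0 \<le> wnorm (?z t)" if "t \<in> {0..T}" for t
      using wnorm_le[OF z[OF that]] wnorm_nonneg[OF z[OF that]] by auto
    have "wnorm_upto T ?z \<le> 4 * (e / 8)"
      unfolding wnorm_upto_def using le assms by (intro cSUP_least) auto
    \<comment> \<open>Boundedness lets the supremum dominate the value at \<open>t = 0\<close>,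
      which shows that it is nonnegative.\<close>
    moreover have "bdd_above ((\<lambda>t. wnorm (?z t)) ` {0..T})"
      using le(1) by (rule bdd_aboveI2)
    then have "wnorm (?z 0) \<le> wnorm_upto T ?z"
      unfolding wnorm_upto_def using assms by (intro cSUP_upper) auto
    ultimately show ?case
      using le(2)[of 0] assms \<open>0 < e\<close> by (auto simp: dist_real_def)
  qed
qed

end

section \<open>Uniqueness and continuity of solutions of the limit system\<close>

context logistic_rate
begin

lemma limit_system_approx_solution:
  assumes "limit_system h nu G" "0 \<le> \<delta>"
  shows "approx_solution T \<delta> (\<lambda>t. pmf (G t))"
  unfolding approx_solution_def
proof (intro ballI allI conjI)
  fix t k assume t: "t \<in> {0..T}"
  show "pmf (G t) k \<in> {0..1}" by (simp add: pmf_le_1)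
  show "\<exists>D. ((\<lambda>s. pmf (G s) k) has_real_derivative D) (at t within {0..}) \<and>
          \<bar>D - rhs (pmf (G t)) k\<bar> \<le> \<delta> * (3 / 2) ^ k"
    using assms t by (intro exI[of _ "rhs (pmf (G t)) k"]) (auto simp: limit_system_iff)
qed

lemma limit_system_unique:
  assumes G: "limit_system h nu G" and G': "limit_system h nu G'" and init: "G 0 = G' 0" and t: "0 \<le> t"
  shows "G t = G' t"
proof (rule pmf_eqI)
  fix k
  \<comment> \<open>The total amplification in \<open>stability\<close>; dividing by it leaves
    exactly \<open>\<epsilon>\<close>.\<close>
  let ?c = "exp ((lip + 2) * t) * (3 / 2) ^ k"
  have close: "\<bar>pmf (G t) k - pmf (G' t) k\<bar> \<le> \<epsilon>" if "0 < \<epsilon>" for \<epsilon>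
  proof -
    have "\<bar>pmf (G t) k - pmf (G' t) k\<bar> \<le> \<epsilon> / ?c * exp ((lip + 2) * t) * (3 / 2) ^ k"
      using that init t by (intro stability[of t] limit_system_approx_solution G G') auto
    then show ?thesis by simp
  qed
  have "\<bar>pmf (G t) k - pmf (G' t) k\<bar> \<le> 0"
    by (rule field_le_epsilon) (simp add: close)
  then show "pmf (G t) k = pmf (G' t) k" by simp
qed

text \<open>By \<open>rhs_bound\<close> all coordinates are Lipschitz in time with one constant, and
  the weighted sum inherits this up to the factor 4.\<close>

lemma limit_system_continuous:
  assumes G: "limit_system h nu G"
  shows "continuous_path G"
  unfolding continuous_path_def
proof (intro allI impI)
  fix t :: real assume t: "0 \<le> t"
  define M where "M = nu * (1 + a) + 1"
  have lipschitz: "\<bar>pmf (G s) k - pmf (G t) k\<bar> \<le> M * \<bar>s - t\<bar>" if "0 \<le> s" for s k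
  proof (rule abs_diff_le_if_deriv_le)
    show "((\<lambda>s. pmf (G s) k) has_real_derivative rhs (pmf (G s)) k) (at s within {0..})" if "0 \<le> s" for s
      using G that by (simp add: limit_system_iff)
    show "\<bar>rhs (pmf (G s)) k\<bar> \<le> M" for s
      unfolding M_def by (rule rhs_bound) (simp add: pmf_le_1)
  qed (use t that in auto)
  have weight: "M * \<bar>s - t\<bar> \<le> M * \<bar>s - t\<bar> * (3 / 2) ^ k" for s k
    using nu_pos a_pos mult_left_mono[of 1 "(3 / 2) ^ k" "M * \<bar>s - t\<bar>"] by (simp add: M_def)
  have le: "\<bar>pmf (G s) k - pmf (G t) k\<bar> \<le> M * \<bar>s - t\<bar> * (3 / 2) ^ k" if "0 \<le> s" for s k
    by (rule order_trans[OF lipschitz[OF that] weight])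
  show "((\<lambda>s. wnorm (\<lambda>k. pmf (G s) k - pmf (G t) k)) \<longlongrightarrow> 0) (at t within {0..})"
  proof (rule tendsto_sandwich)
    show "\<forall>\<^sub>F s in at t within {0..}. 0 \<le> wnorm (\<lambda>k. pmf (G s) k - pmf (G t) k)"
      using wnorm_nonneg[OF le] by (auto simp: eventually_at_filter)
    show "\<forall>\<^sub>F s in at t within {0..}. wnorm (\<lambda>k. pmf (G s) k - pmf (G t) k) \<le> 4 * (M * \<bar>s - t\<bar>)"
      using wnorm_le[OF le] by (auto simp: eventually_at_filter)
    have "((\<lambda>s. 4 * (M * \<bar>s - t\<bar>)) \<longlongrightarrow> 4 * (M * \<bar>t - t\<bar>)) (at t within {0..})"
      by (intro tendsto_intros)
    then show "((\<lambda>s. 4 * (M * \<bar>s - t\<bar>)) \<longlongrightarrow> 0) (at t within {0..})" by simp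
  qed simp
qed

end

section \<open>Reflected distributions and the convergence theorem\<close>

lemma reflect_bounds: "reflect C p k \<in> {0..1}"
  by (simp add: reflect_def pmf_le_1)

lemma reflect_mass_le: "(\<Sum>k\<le>K. reflect C p k) \<le> 1"
proof -
  \<comment> \<open>Restricting to \<open>k <= C\<close> discards only zeros and makes the truncated
    subtraction \<open>C - k\<close> injective for the reindexing.\<close>
  have "(\<Sum>k\<le>K. reflect C p k) = (\<Sum>k\<in>{..K} \<inter> {..C}. pmf p (C - k))"
    unfolding reflect_def sum.inter_restrict[OF finite_atMost] by simp
  also have "\<dots> = (\<Sum>j\<in>(\<lambda>k. C - k) ` ({..K} \<inter> {..C}). pmf p j)"
    by (subst sum.reindex) (auto intro!: inj_onI)
  also have "\<dots> \<le> 1"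
    by (simp add: measure_measure_pmf_finite[symmetric])
  finally show ?thesis .
qed

theorem proposition3p2:
  fixes a nu :: real and h :: "real \<Rightarrow> real"
    and x :: "nat \<Rightarrow> real \<Rightarrow> nat pmf" and q0 :: "nat pmf"
  assumes "a > 1"
    and "\<And>u. h u = 1 + a * u * (1 - u)"
    and "nu > 0"
    and "\<And>C. C \<ge> 1 \<Longrightarrow> DAR h (nu * real C) C (x C)"
    and "(\<lambda>C. wnorm (\<lambda>k. reflect C (x C 0) k - pmf q0 k)) \<longlonglongrightarrow> 0"
  shows "\<exists>G :: real \<Rightarrow> nat pmf.
      continuous_path G \<and> limit_system h nu G \<and> G 0 = q0 \<and>
      (\<forall>G'. continuous_path G' \<and> limit_system h nu G' \<and> G' 0 = q0 \<longrightarrow> (\<forall>t\<ge>0. G' t = G t)) \<and>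
      (\<forall>T>0. (\<lambda>C. wnorm_upto T (\<lambda>t k. reflect C (x C (t / real C)) k - pmf (G t) k))
               \<longlonglongrightarrow> 0)"
proof -
  interpret logistic_rate a nu h
    by unfold_locales (use assms(1-3) in auto)
  \<comment> \<open>\<open>DAR\<close> is assumed from \<open>C = 1\<close> on, so index
    \<open>n\<close> of the scheme stands for \<open>C = n + 1\<close>.\<close>
  interpret approximation_scheme a nu h "\<lambda>n t. reflect (Suc n) (x (Suc n) (t / real (Suc n)))"
    "\<lambda>n. 2 / real (Suc n)" "pmf q0"
  proof unfold_locales
    show "approx_solution T (2 / real (Suc n)) (\<lambda>t. reflect (Suc n) (x (Suc n) (t / real (Suc n))))" for T n
      by (rule DAR_rescaled[OF _ assms(4)]) simp_all
    show "(\<lambda>n. 2 / real (Suc n)) \<longlonglongrightarrow> 0"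
      by (rule LIMSEQ_Suc[OF lim_const_over_n])
    show "\<forall>\<^sub>F n in sequentially. \<forall>k.
        \<bar>reflect (Suc n) (x (Suc n) (0 / real (Suc n))) k - pmf q0 k\<bar> \<le> \<epsilon> * (3 / 2) ^ k" if "0 < \<epsilon>" for \<epsilon>
    proof (rule eventually_le_geometric[OF _ _ that])
      show "\<bar>reflect (Suc n) (x (Suc n) (0 / real (Suc n))) k - pmf q0 k\<bar> \<le> 1" for n k
        using pmf_le_1[of q0 k] pmf_nonneg[of q0 k] reflect_bounds[of "Suc n" "x (Suc n) (0 / real (Suc n))" k]
        unfolding atLeastAtMost_iff by linarith
      show "(\<lambda>n. wnorm (\<lambda>k. reflect (Suc n) (x (Suc n) (0 / real (Suc n))) k - pmf q0 k)) \<longlonglongrightarrow> 0"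
        using LIMSEQ_Suc[OF assms(5)] by simp
    qed
    show "pmf q0 sums 1"
    proof -
      have "summable (pmf q0)" "(\<Sum>k. pmf q0 k) = 1"
        using pmf_abs_summable[of q0 UNIV] infsetsum_pmf_eq_1[of q0 UNIV]
        by (simp_all add: abs_summable_on_nat_iff' infsetsum_nat')
      then show ?thesis by (simp add: sums_iff)
    qed
    show "(\<Sum>k\<le>K. reflect (Suc n) (x (Suc n) (t / real (Suc n))) k) \<le> 1" for t K n
      by (rule reflect_mass_le)
  qed
  have path0: "path 0 = q0"
    by (rule pmf_eqI) (simp only: pmf_path[OF order_refl] \<Gamma>_init)
  \<comment> \<open>The term at \<open>C = 0\<close> does not affect the limit, so convergence of
    the shifted sequence suffices.\<close>
  have "(\<lambda>C. wnorm_upto T (\<lambda>t k. reflect C (x C (t / real C)) k - pmf (path t) k)) \<longlonglongrightarrow> 0"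
    if "0 < T" for T
    by (rule LIMSEQ_imp_Suc) (rule wnorm_upto_path[OF that])
  then show ?thesis
    using limit_system_path path0
    by (intro exI[of _ path] conjI allI impI)
       (auto intro: limit_system_continuous limit_system_unique)
qed

end
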